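(* Let $a_1a_2\cdots = 3\,0\,1\,0^3\,1\,0^5\,1\cdots$ be the sequence consisting of $a_1=3$ followed by the concatenation of the blocks $0^{2k-1}1$ for $k=1,2,3,\ldots$ in this order. Then there exists a real number $\beta>1$ such that $a_1a_2\cdots$ is the $(-\beta)$-expansion of $\tfrac{-\beta}{\beta+1}$, and (for this $\beta$) the set $\mathbb{Z}_{-\beta}$ is not uniformly discrete.
   Context: For real $\beta>1$, the $(-\beta)$-transformation is $T_{-\beta}:\big[\tfrac{-\beta}{\beta+1},\tfrac{1}{\beta+1}\big)\to\big[\tfrac{-\beta}{\beta+1},\tfrac{1}{\beta+1}\big)$, $x\mapsto -\beta x-\big\lfloor \tfrac{\beta}{\beta+1}-\beta x\big\rfloor$. The set of $(-\beta)$-integers is $\mathbb{Z}_{-\beta}=\bigcup_{n\ge0}(-\beta)^n\,T_{-\beta}^{-n}(0)$, where $T_{-\beta}^{-n}(0)$ is the preimage of $0$ under the $n$-th iterate. With $t_n=T_{-\beta}^n\big(\tfrac{-\beta}{\beta+1}\big)$ for $n\ge0$, the $(-\beta)$-expansion of $\tfrac{-\beta}{\beta+1}$ is the sequence $a_1a_2\cdots$ given by $a_n=\big\lfloor \tfrac{\beta}{\beta+1}-\beta t_{n-1}\big\rfloor$, $n\ge1$. A set $S\subset\mathbb{R}$ is uniformly discrete if there is $r>0$ such that each interval of length $r$ contains at most one point of $S$. The notation $0^m$ means the digit $0$ repeated $m$ times. *)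

theory Defs
  imports "HOL-Analysis.Analysis" "HOL-Library.Stream"
begin

definition negbeta_dom :: "real \<Rightarrow> real set" where
  "negbeta_dom \<beta> = {- \<beta> / (\<beta> + 1) ..< 1 / (\<beta> + 1)}"

definition negbeta_digit :: "real \<Rightarrow> real \<Rightarrow> int" where
  "negbeta_digit \<beta> x = \<lfloor>\<beta> / (\<beta> + 1) - \<beta> * x\<rfloor>"

text \<open>The transformation is a total function here; it is only meaningful on \<^term>\<open>negbeta_dom \<beta>\<close>,
  which it maps into itself.\<close>

definition negbeta_T :: "real \<Rightarrow> real \<Rightarrow> real" where
  "negbeta_T \<beta> x = - \<beta> * x - of_int (negbeta_digit \<beta> x)"

lemma negbeta_T_in_dom:
  assumes "\<beta> > 1"
  shows "negbeta_T \<beta> x \<in> negbeta_dom \<beta>"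
proof -
  have "1 / (\<beta> + 1) = 1 - \<beta> / (\<beta> + 1)"
    using assms by (simp add: field_simps)
  then show ?thesis
    unfolding negbeta_T_def negbeta_digit_def negbeta_dom_def by simp linarith
qed

text \<open>Streams are indexed from \<open>0\<close>: entry \<open>n\<close> is the digit of the \<open>n\<close>-th iterate of \<^term>\<open>x\<close>,
  conventionally numbered \<open>n + 1\<close>.\<close>

definition negbeta_expansion :: "real \<Rightarrow> real \<Rightarrow> int stream" where
  "negbeta_expansion \<beta> x = smap (negbeta_digit \<beta>) (siterate (negbeta_T \<beta>) x)"

definition negbeta_integers :: "real \<Rightarrow> real set" where
  "negbeta_integers \<beta> =
     (\<Union>n. (\<lambda>x. (- \<beta>) ^ n * x) ` {x \<in> negbeta_dom \<beta>. (negbeta_T \<beta> ^^ n) x = 0})"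

definition block_word :: "int stream" where
  "block_word = 3 ## flat (smap (\<lambda>k. replicate (2 * k - 1) 0 @ [1]) (fromN 1))"

text \<open>On the real line, \<^const>\<open>uniform_discrete\<close> says that, for some \<open>r > 0\<close>, every interval of
  length \<open>r\<close> contains at most one point of the set.\<close>

lemma uniform_discrete_real_iff:
  fixes S :: "real set"
  shows "uniform_discrete S \<longleftrightarrow>
    (\<exists>r>0. \<forall>c. \<forall>x \<in> S \<inter> {c..c + r}. \<forall>y \<in> S \<inter> {c..c + r}. x = y)"
proof
  assume "uniform_discrete S"
  then obtain e where "e > 0" and e: "\<And>x y. x \<in> S \<Longrightarrow> y \<in> S \<Longrightarrow> dist x y < e \<Longrightarrow> x = y"
    unfolding uniform_discrete_def by blast
  have "x = y" if "x \<in> S \<inter> {c..c + e / 2}" "y \<in> S \<inter> {c..c + e / 2}" for c x y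
  proof (rule e)
    show "dist x y < e"
      using that \<open>e > 0\<close> by (auto simp: dist_real_def)
  qed (use that in auto)
  with \<open>e > 0\<close> show "\<exists>r>0. \<forall>c. \<forall>x \<in> S \<inter> {c..c + r}. \<forall>y \<in> S \<inter> {c..c + r}. x = y"
    by (intro exI[of _ "e / 2"]) auto
next
  assume "\<exists>r>0. \<forall>c. \<forall>x \<in> S \<inter> {c..c + r}. \<forall>y \<in> S \<inter> {c..c + r}. x = y"
  then obtain r where "r > 0"
    and r: "\<And>c x y. x \<in> S \<inter> {c..c + r} \<Longrightarrow> y \<in> S \<inter> {c..c + r} \<Longrightarrow> x = y"
    by blast
  have "x = y" if "x \<in> S" "y \<in> S" "dist x y < r" for x y
    by (rule r[of _ "min x y"]) (use that in \<open>auto simp: dist_real_def\<close>)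
  with \<open>r > 0\<close> show "uniform_discrete S"
    unfolding uniform_discrete_def by blast
qed

end

theory Submission
  imports Defs
begin

text \<open>The base \<open>\<beta>\<close> is obtained from the intermediate value theorem as a solution in \<open>[3, 4]\<close> of
  \<open>(\<Sum>n\<ge>1. a\<^sub>n (-\<beta>)\<^bsup>-n\<^esup>) = -\<beta>/(\<beta>+1)\<close>. All digits except the first lie in \<open>{0, 1}\<close>, so for
  \<open>\<beta> \<ge> 3\<close> every tail has its value in the domain, and the tail values are the orbit \<open>t\<^sub>n\<close>.
  Because \<open>-\<beta>/(\<beta>+1)\<close> and \<open>1/(\<beta>+1)\<close> differ by 1, the words \<open>1 a\<^sub>1 \<dots> a\<^sub>m\<^sub>+\<^sub>1\<close> and \<open>a\<^sub>1 \<dots> a\<^sub>m\<close>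
  represent integers whose difference is \<open>t\<^sub>m - t\<^sub>m\<^sub>+\<^sub>1\<close>. At the start of a long run of zeros
  this is \<open>(1+\<beta>) t\<^sub>m\<close>, which is nonzero and arbitrarily small.\<close>

section \<open>The digit sequence\<close>

text \<open>The first block is a parameter, so that removing it leaves a sequence of the same kind;
  \<open>blocks_from 1\<close> is \<open>block_word\<close> without its leading 3.\<close>

definition blocks_from :: "nat \<Rightarrow> int stream" where
  "blocks_from k = flat (smap (\<lambda>k. replicate (2 * k - 1) 0 @ [1]) (fromN k))"

lemma blocks_from_unfold:
  "blocks_from k = (replicate (2 * k - 1) 0 @ [1]) @- blocks_from (Suc k)"
  unfolding blocks_from_def by (subst siterate.code) simp

lemma snth_blocks_from_less:
  assumes "n < 2 * k"
  shows "blocks_from k !! n = (if n = 2 * k - 1 then 1 else 0)"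
  using assms by (subst blocks_from_unfold) (auto simp: shift_snth nth_append simp del: shift.simps)

lemma snth_blocks_from_add:
  assumes "k \<ge> 1"
  shows "blocks_from k !! (2 * k + n) = blocks_from (Suc k) !! n"
  using assms by (subst blocks_from_unfold) (auto simp: shift_snth simp del: shift.simps)

text \<open>Every block has even length \<open>2 * k\<close> and ends in its only 1, so blocks begin
  at even offsets and the ones sit at odd ones. The leading 3 of \<open>block_word\<close> later
  shifts these to even indices.\<close>

lemma snth_blocks_from_cases:
  assumes "k \<ge> 1"
  shows "blocks_from k !! n = 0 \<or> odd n \<and> blocks_from k !! n = 1"
  using assms
proof (induction n arbitrary: k rule: less_induct)
  case (less n)
  show ?case
  proof (cases "n < 2 * k")
    case True
    then show ?thesis
      using less.prems by (auto simp: snth_blocks_from_less)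
  next
    case False
    then obtain m where n: "n = 2 * k + m"
      using le_Suc_ex by (metis not_less)
    have "blocks_from (Suc k) !! m = 0 \<or> odd m \<and> blocks_from (Suc k) !! m = 1"
      by (rule less.IH) (use n less.prems in auto)
    then show ?thesis
      using less.prems by (simp add: n snth_blocks_from_add)
  qed
qed

text \<open>The first \<open>k\<close> blocks have total length 2 + 4 + ... + 2k = k(k + 1).\<close>

lemma snth_blocks_from_one:
  "blocks_from 1 !! (k * (k + 1) + n) = blocks_from (Suc k) !! n"
proof (induction k arbitrary: n)
  case (Suc k)
  have "Suc k * (Suc k + 1) + n = k * (k + 1) + (2 * Suc k + n)"
    by simp
  then show ?case
    using Suc[of "2 * Suc k + n"] snth_blocks_from_add[of "Suc k" n] by (metis le_add1 plus_1_eq_Suc)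
qed simp

lemma block_word_eq: "block_word = 3 ## blocks_from 1"
  by (simp add: block_word_def blocks_from_def)

lemma snth_block_word_0: "block_word !! 0 = 3"
  by (simp add: block_word_eq)

lemma snth_block_word_cases:
  assumes "n \<ge> 1"
  shows "block_word !! n = 0 \<or> even n \<and> block_word !! n = 1"
proof -
  from assms obtain m where "n = Suc m"
    by (cases n) auto
  then show ?thesis
    using snth_blocks_from_cases[of 1 m] by (simp add: block_word_eq)
qed

lemma block_word_zero_run:
  obtains m where "m \<ge> 1" "\<And>i. i \<le> 2 * k \<Longrightarrow> block_word !! (m + i) = 0"
    "block_word !! (m + (2 * k + 1)) = 1"
proof
  have *: "block_word !! (Suc (k * (k + 1)) + i) = blocks_from (Suc k) !! i" for i
    using snth_blocks_from_one[of k i] by (simp add: block_word_eq)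
  show "Suc (k * (k + 1)) \<ge> 1"
    by simp
  show "block_word !! (Suc (k * (k + 1)) + i) = 0" if "i \<le> 2 * k" for i
    using that unfolding * by (subst snth_blocks_from_less) auto
  show "block_word !! (Suc (k * (k + 1)) + (2 * k + 1)) = 1"
    unfolding * by (subst snth_blocks_from_less) auto
qed

section \<open>Values of digit sequences\<close>

text \<open>With \<open>w = - 1 / \<beta>\<close> the digit of index 0 has weight \<open>w\<close>,
  hence the factor in front. Taking \<open>w\<close> as the variable gives a power series, whose
  continuity is used to find the base.\<close>

definition digit_val :: "real \<Rightarrow> (nat \<Rightarrow> real) \<Rightarrow> real" where
  "digit_val w b = w * (\<Sum>n. b n * w ^ n)"

lemma summable_digits:
  fixes b :: "nat \<Rightarrow> real"
  assumes "\<And>n. \<bar>b n\<bar> \<le> C" "\<bar>w\<bar> < 1"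
  shows "summable (\<lambda>n. b n * w ^ n)"
proof (rule summable_comparison_test')
  show "summable (\<lambda>n. C * \<bar>w\<bar> ^ n)"
    using assms by (intro summable_mult summable_geometric) auto
  show "norm (b n * w ^ n) \<le> C * \<bar>w\<bar> ^ n" if "n \<ge> 0" for n
    using assms(1)[of n] by (simp add: abs_mult power_abs mult_right_mono)
qed

lemma digit_val_Suc:
  assumes "\<And>n. \<bar>b n\<bar> \<le> C" "\<bar>w\<bar> < 1"
  shows "digit_val w b = w * (b 0 + digit_val w (\<lambda>n. b (Suc n)))"
proof -
  have "(\<Sum>n. b n * w ^ n) = b 0 + (\<Sum>n. b (Suc n) * w ^ Suc n)"
    using suminf_split_head[OF summable_digits[of b C w, OF assms]] by simp
  also have "(\<Sum>n. b (Suc n) * w ^ Suc n) = w * (\<Sum>n. b (Suc n) * w ^ n)"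
    using suminf_mult[OF summable_digits[of "\<lambda>n. b (Suc n)" C w, OF assms(1) assms(2)], of w]
    by (simp add: mult_ac)
  finally show ?thesis
    by (simp add: digit_val_def)
qed

lemma digit_val_drop:
  assumes "\<And>n. \<bar>b n\<bar> \<le> C" "\<bar>w\<bar> < 1"
  shows "digit_val w b = digit_val w (\<lambda>n. if n < m then b n else 0)
           + w ^ m * digit_val w (\<lambda>n. b (m + n))"
  using assms(1)
proof (induction m arbitrary: b)
  case 0
  then show ?case by (simp add: digit_val_def)
next
  case (Suc m)
  have "0 \<le> C"
    using Suc.prems[of 0] by linarith
  have "digit_val w (\<lambda>n. if n < Suc m then b n else 0)
      = w * (b 0 + digit_val w (\<lambda>n. if n < m then b (Suc n) else 0))"
    by (subst digit_val_Suc[of _ C]) (use Suc.prems assms(2) \<open>0 \<le> C\<close> in auto)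
  then show ?case
    using digit_val_Suc[of b C w, OF Suc.prems assms(2)] Suc.IH[of "\<lambda>n. b (Suc n)", OF Suc.prems]
    by (simp add: algebra_simps)
qed

lemma abs_digit_val_le:
  assumes "\<And>n. \<bar>b n\<bar> \<le> 1" "\<bar>w\<bar> \<le> 1 / 3"
  shows "\<bar>digit_val w b\<bar> \<le> 1 / 2"
proof -
  have geo: "(\<lambda>n. (1 / 3 :: real) ^ n) sums (3 / 2)"
    using geometric_sums[of "1 / 3 :: real"] by simp
  have "norm (\<Sum>n. b n * w ^ n) \<le> (\<Sum>n. (1 / 3) ^ n)"
  proof (rule norm_suminf_le)
    show "norm (b n * w ^ n) \<le> (1 / 3) ^ n" for n
      using mult_mono[OF assms(1)[of n] power_mono[OF assms(2), of n]]
      by (simp add: abs_mult power_abs)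
  qed (use geo in \<open>simp add: sums_iff\<close>)
  also have "\<dots> = 3 / 2"
    using geo by (simp add: sums_iff)
  finally have "\<bar>w\<bar> * \<bar>\<Sum>n. b n * w ^ n\<bar> \<le> 1 / 3 * (3 / 2)"
    using assms(2) by (intro mult_mono) auto
  then show ?thesis
    by (simp add: digit_val_def abs_mult)
qed

lemma isCont_digit_val:
  assumes "\<And>n. \<bar>b n\<bar> \<le> C" "\<bar>w\<bar> < 1"
  shows "isCont (\<lambda>w. digit_val w b) w"
proof -
  \<comment> \<open>The midpoint of \<open>\<bar>w\<bar>\<close> and 1 is a point of convergence of
    larger modulus than \<open>w\<close>.\<close>
  have "summable (\<lambda>n. b n * ((\<bar>w\<bar> + 1) / 2) ^ n)"
    using assms by (intro summable_digits) auto
  then have "isCont (\<lambda>w. \<Sum>n. b n * w ^ n) w"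
    by (rule isCont_powser) (use assms(2) in auto)
  then show ?thesis
    unfolding digit_val_def by (intro continuous_intros)
qed

section \<open>Orbits of the transformation\<close>

text \<open>The domain is half-open of length 1, so at most one integer \<open>d\<close> can bring
  the image into it.\<close>

lemma negbeta_step:
  assumes "\<beta> > 1" "- \<beta> * x - of_int d \<in> negbeta_dom \<beta>"
  shows "negbeta_digit \<beta> x = d" "negbeta_T \<beta> x = - \<beta> * x - of_int d"
proof -
  have "1 / (\<beta> + 1) = 1 - \<beta> / (\<beta> + 1)"
    using assms(1) by (simp add: field_simps)
  then show "negbeta_digit \<beta> x = d"
    using assms(2) unfolding negbeta_digit_def negbeta_dom_def by (simp add: floor_eq_iff)
  then show "negbeta_T \<beta> x = - \<beta> * x - of_int d"
    by (simp add: negbeta_T_def)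
qed

text \<open>Multiplying a value by \<open>- \<beta>\<close> and subtracting its first digit yields
  the value of the next tail. A digit is decided by where the image lands, so membership is asked of
  the tails from \<open>m = 1\<close> on, which admits a large first digit such as 3.\<close>

lemma negbeta_orbit_digit_val:
  fixes d :: "nat \<Rightarrow> int"
  assumes "\<beta> > 1" and bd: "\<And>n. \<bar>d n\<bar> \<le> C"
    and dom: "\<And>m. m \<ge> 1 \<Longrightarrow> digit_val (- 1 / \<beta>) (\<lambda>n. d (m + n)) \<in> negbeta_dom \<beta>"
  shows "(negbeta_T \<beta> ^^ m) (digit_val (- 1 / \<beta>) (\<lambda>n. d n))
      = digit_val (- 1 / \<beta>) (\<lambda>n. d (m + n))" (is "_ = ?t m")
    and "negbeta_digit \<beta> (digit_val (- 1 / \<beta>) (\<lambda>n. d (m + n))) = d m"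
proof -
  have "?t m = - 1 / \<beta> * (d m + ?t (Suc m))" for m
    using digit_val_Suc[of "\<lambda>n. real_of_int (d (m + n))" "real_of_int C" "- 1 / \<beta>"] bd assms(1)
    by (simp flip: of_int_abs)
  moreover have "- \<beta> * (- 1 / \<beta> * z) = z" for z
    using assms(1) by simp
  ultimately have eq: "- \<beta> * ?t m - d m = ?t (Suc m)" for m
    by (metis add_diff_cancel_left')
  have step: "negbeta_digit \<beta> (?t m) = d m" "negbeta_T \<beta> (?t m) = ?t (Suc m)" for m
    using negbeta_step[of \<beta> "?t m" "d m"] assms(1) dom[of "Suc m"] eq[of m] by auto
  show "(negbeta_T \<beta> ^^ m) (digit_val (- 1 / \<beta>) (\<lambda>n. d n)) = ?t m"
    by (induction m) (simp_all only: funpow.simps id_apply o_apply add_0 step(2))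
  show "negbeta_digit \<beta> (?t m) = d m"
    by (rule step(1))
qed

text \<open>The weight of the first digit is negative, so the value is largest when
  \<open>b 0 = 0\<close>, and then it is at most 1/(2\<beta>). No bound by 1 is put on
  \<open>b 0\<close>, so that prefixes starting with 3 are covered.\<close>

lemma digit_val_less_dom:
  assumes "\<beta> \<ge> 3" "b 0 \<ge> 0" "\<And>n. \<bar>b n\<bar> \<le> C" "\<And>n. \<bar>b (Suc n)\<bar> \<le> 1"
  shows "digit_val (- 1 / \<beta>) b < 1 / (\<beta> + 1)"
proof -
  have "\<bar>digit_val (- 1 / \<beta>) (\<lambda>n. b (Suc n))\<bar> \<le> 1 / 2"
    using assms by (intro abs_digit_val_le) (auto simp: field_simps)
  then have "- (b 0 + digit_val (- 1 / \<beta>) (\<lambda>n. b (Suc n))) \<le> 1 / 2"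
    using assms(2) by linarith
  then have "- (b 0 + digit_val (- 1 / \<beta>) (\<lambda>n. b (Suc n))) / \<beta> \<le> (1 / 2) / \<beta>"
    using assms(1) by (intro divide_right_mono) auto
  also have "(1 / 2) / \<beta> < 1 / (\<beta> + 1)"
    using assms(1) by (simp add: field_simps)
  also have "- (b 0 + digit_val (- 1 / \<beta>) (\<lambda>n. b (Suc n))) / \<beta> = digit_val (- 1 / \<beta>) b"
    by (subst digit_val_Suc[of b C]) (use assms(1,3) in \<open>simp_all only: times_divide_eq_left mult_minus_left mult_1_left, auto\<close>)
  finally show ?thesis .
qed

lemma digit_val_in_dom:
  assumes "\<beta> \<ge> 3" "\<And>n. 0 \<le> b n" "\<And>n. b n \<le> 1"
  shows "digit_val (- 1 / \<beta>) b \<in> negbeta_dom \<beta>"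
proof -
  have abs: "\<bar>b n\<bar> \<le> 1" for n
    using assms(2,3)[of n] by simp
  have "\<bar>digit_val (- 1 / \<beta>) b\<bar> \<le> 1 / 2"
    using assms abs by (intro abs_digit_val_le) (auto simp: field_simps)
  moreover have "1 / 2 \<le> \<beta> / (\<beta> + 1)"
    using assms(1) by (simp add: field_simps)
  moreover have "digit_val (- 1 / \<beta>) b < 1 / (\<beta> + 1)"
    using assms abs by (intro digit_val_less_dom[of _ _ 1]) auto
  ultimately show ?thesis
    by (simp add: negbeta_dom_def)
qed

lemma negbeta_integersI:
  assumes "x \<in> negbeta_dom \<beta>" "(negbeta_T \<beta> ^^ n) x = 0"
  shows "(- \<beta>) ^ n * x \<in> negbeta_integers \<beta>"
  unfolding negbeta_integers_def by (intro UN_I[of n] image_eqI[of _ _ x]) (use assms in auto)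

text \<open>This puts the digit 1 in front of a word: \<open>?y\<close> is the preimage of
  \<open>x\<close> under the branch with digit 1. It stays above the left endpoint because \<beta> +
  2 \<le> \<beta>^2 for \<beta> \<ge> 2.\<close>

lemma negbeta_integers_one_plus:
  assumes "\<beta> \<ge> 2" "x \<in> negbeta_dom \<beta>" "(negbeta_T \<beta> ^^ n) x = 0"
  shows "(- \<beta>) ^ n * (1 + x) \<in> negbeta_integers \<beta>"
proof -
  let ?y = "- (1 + x) / \<beta>"
  have x: "- (\<beta> / (\<beta> + 1)) \<le> x" "x < 1 / (\<beta> + 1)"
    using assms(2) by (auto simp: negbeta_dom_def)
  have "\<beta> / (\<beta> + 1) \<le> 1"
    using assms(1) by (simp add: field_simps)
  with x have "?y \<le> 0"
    using assms(1) by (intro divide_nonpos_pos) linarith+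
  also have "0 < 1 / (\<beta> + 1)"
    using assms(1) by simp
  finally have up: "?y < 1 / (\<beta> + 1)" .
  have "(1 + x) / \<beta> \<le> (1 + 1 / (\<beta> + 1)) / \<beta>"
    using x assms(1) by (intro divide_right_mono) auto
  also have "\<dots> = (\<beta> + 2) / (\<beta> * (\<beta> + 1))"
    using assms(1) by (simp add: field_simps)
  also have "\<dots> \<le> (\<beta> * \<beta>) / (\<beta> * (\<beta> + 1))"
  proof (rule divide_right_mono)
    have "2 * \<beta> \<le> \<beta> * \<beta>"
      using assms(1) by (intro mult_right_mono) auto
    then show "\<beta> + 2 \<le> \<beta> * \<beta>"
      using assms(1) by linarith
  qed (use assms(1) in auto)
  also have "\<dots> = \<beta> / (\<beta> + 1)"
    using assms(1) by simp
  finally have "- \<beta> / (\<beta> + 1) \<le> ?y"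
    unfolding minus_divide_left[symmetric] by simp
  with up have y: "?y \<in> negbeta_dom \<beta>"
    by (simp add: negbeta_dom_def)
  have "negbeta_T \<beta> ?y = x"
    using negbeta_step(2)[of \<beta> ?y 1] assms(1,2) by simp
  then have "(negbeta_T \<beta> ^^ Suc n) ?y = 0"
    using assms(3) by (simp add: funpow_swap1)
  moreover have "- \<beta> * (- z / \<beta>) = z" for z
    using assms(1) by simp
  then have "(- \<beta>) ^ Suc n * ?y = (- \<beta>) ^ n * (1 + x)"
    by (simp only: power_Suc2 mult.assoc)
  ultimately show ?thesis
    using negbeta_integersI[OF y, of "Suc n"] by (simp only:)
qed

section \<open>The base and its integers\<close>

declare snth.simps [simp del]

abbreviation block_digit :: "nat \<Rightarrow> real" where
  "block_digit n \<equiv> of_int (block_word !! n)"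

lemma block_digit_bounds:
  shows "n \<ge> 1 \<Longrightarrow> 0 \<le> block_digit n \<and> block_digit n \<le> 1"
    and "0 \<le> block_digit n"
    and "\<bar>block_digit n\<bar> \<le> 3"
proof -
  have *: "block_digit n = 0 \<or> block_digit n = 1" if "n \<ge> 1"
    using snth_block_word_cases[OF that] by auto
  then show "n \<ge> 1 \<Longrightarrow> 0 \<le> block_digit n \<and> block_digit n \<le> 1"
    by auto
  show "0 \<le> block_digit n" "\<bar>block_digit n\<bar> \<le> 3"
    using * by (cases "n = 0"; force simp: snth_block_word_0)+
qed

lemma block_base_exists:
  obtains \<beta> where "3 \<le> \<beta>" "\<beta> \<le> 4" "digit_val (- 1 / \<beta>) block_digit = - \<beta> / (\<beta> + 1)"
proof -
  \<comment> \<open>For \<open>w = - 1 / \<beta>\<close> the target -\<beta>/(\<beta>+1) equals 1/(w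
    - 1), so a zero of \<open>f\<close> gives the base.\<close>
  define f where "f w = digit_val w block_digit - 1 / (w - 1)" for w
  \<comment> \<open>Splitting off both digits 3 and 0 leaves a remainder of at most w^2/2. At -1/4
    this is 1/32, below the margin 4/5 - 3/4 = 1/20; at -1/3 it is 1/18, below 1 - 3/4 =
    1/4.\<close>
  have eq: "digit_val w block_digit = w * (3 + w * digit_val w (\<lambda>n. block_digit (Suc (Suc n))))"
    if "\<bar>w\<bar> < 1" for w
  proof -
    have "block_digit (Suc 0) = 0"
      using snth_block_word_cases[of 1] by simp
    then show ?thesis
      using digit_val_Suc[of block_digit 3 w] digit_val_Suc[of "\<lambda>n. block_digit (Suc n)" 3 w]
        that block_digit_bounds(3) by (simp add: snth_block_word_0)
  qed
  have tail: "\<bar>digit_val w (\<lambda>n. block_digit (Suc (Suc n)))\<bar> \<le> 1 / 2" if "\<bar>w\<bar> \<le> 1 / 3" for w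
    using block_digit_bounds(1) that by (intro abs_digit_val_le) auto
  have "f (- 1 / 3) \<le> 0" "0 \<le> f (- 1 / 4)"
    unfolding f_def using eq[of "- 1 / 3"] tail[of "- 1 / 3"] eq[of "- 1 / 4"] tail[of "- 1 / 4"]
    by (simp_all add: algebra_simps)
  moreover have "continuous_on {- 1 / 3..- 1 / 4} f"
    unfolding f_def
    by (intro continuous_at_imp_continuous_on ballI continuous_intros isCont_digit_val[of _ 3]
        block_digit_bounds(3)) auto
  ultimately obtain w where w: "- 1 / 3 \<le> w" "w \<le> - 1 / 4" "f w = 0"
    using IVT'[of f "- 1 / 3" 0 "- 1 / 4"] by auto
  show thesis
  proof
    show "3 \<le> - 1 / w" "- 1 / w \<le> 4"
      using w by (auto simp: field_simps)
    show "digit_val (- 1 / (- 1 / w)) block_digit = - (- 1 / w) / (- 1 / w + 1)"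
      using w by (simp add: f_def field_simps)
  qed
qed

lemma block_tail_in_dom:
  assumes "\<beta> \<ge> 3" "m \<ge> 1"
  shows "digit_val (- 1 / \<beta>) (\<lambda>n. block_digit (m + n)) \<in> negbeta_dom \<beta>"
  using assms block_digit_bounds(1) by (intro digit_val_in_dom) auto

text \<open>The digit 1 occurs only at even indices, so all terms of the tail are nonpositive. This makes
  every prefix of the digit sequence admissible: its value is at least \<open>- \<beta> / (\<beta> + 1)\<close>.\<close>

lemma block_tail_nonpos:
  assumes "\<beta> \<ge> 3" "m \<ge> 1"
  shows "(- 1 / \<beta>) ^ m * digit_val (- 1 / \<beta>) (\<lambda>n. block_digit (m + n)) \<le> 0"
proof -
  let ?w = "- 1 / \<beta>"
  have sm: "summable (\<lambda>n. block_digit (m + n) * ?w ^ n)"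
    using assms block_digit_bounds(3) by (intro summable_digits[of _ 3]) auto
  \<comment> \<open>The digit of index \<open>m + n\<close> has weight
    \<open>?w ^ Suc (m + n)\<close>, an odd power of a negative number wherever the digit is
    1.\<close>
  have "?w ^ Suc m * (block_digit (m + n) * ?w ^ n) \<le> 0" for n
  proof (cases "block_digit (m + n) = 0")
    case False
    then have "even (m + n)" "block_digit (m + n) = 1"
      using snth_block_word_cases[of "m + n"] assms(2) by auto
    then have "?w ^ Suc (m + n) \<le> 0"
      using assms(1) by (subst power_le_zero_eq) auto
    then show ?thesis
      using \<open>block_digit (m + n) = 1\<close> by (simp add: power_add)
  qed simp
  then have "(\<Sum>n. ?w ^ Suc m * (block_digit (m + n) * ?w ^ n)) \<le> (\<Sum>n. 0)"
    using sm by (intro suminf_le summable_mult) auto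
  then show ?thesis
    using suminf_mult[OF sm, of "?w ^ Suc m"] by (simp add: digit_val_def mult_ac)
qed

text \<open>Cutting the sequence after \<open>m\<close> digits removes a nonpositive tail, so
  \<open>x\<close> lies at or to the right of the left endpoint. Its orbit then reads the first
  \<open>m\<close> digits and reaches the value of the zero sequence.\<close>

lemma block_prefix:
  fixes \<beta> :: real and m :: nat
  defines "x \<equiv> digit_val (- 1 / \<beta>) (\<lambda>n. if n < m then block_digit n else 0)"
  assumes "\<beta> \<ge> 3" "digit_val (- 1 / \<beta>) block_digit = - \<beta> / (\<beta> + 1)" "m \<ge> 1"
  shows "x \<in> negbeta_dom \<beta>" "(negbeta_T \<beta> ^^ m) x = 0"
    "(- \<beta>) ^ m * x = (- \<beta>) ^ m * (- \<beta> / (\<beta> + 1)) - digit_val (- 1 / \<beta>) (\<lambda>n. block_digit (m + n))"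
proof -
  let ?w = "- 1 / \<beta>" and ?t = "digit_val (- 1 / \<beta>) (\<lambda>n. block_digit (m + n))"
  define d where "d n = (if n < m then block_word !! n else 0)" for n
  have d_real: "(if n < m then block_digit n else 0) = real_of_int (d n)" for n
    by (simp add: d_def)
  have d1: "n \<ge> 1 \<Longrightarrow> 0 \<le> real_of_int (d n) \<and> real_of_int (d n) \<le> 1" for n
    using block_digit_bounds(1)[of n] by (simp add: d_def)
  have "\<bar>block_word !! n\<bar> \<le> 3" for n
    using block_digit_bounds(3)[of n] by simp
  then have d3: "\<bar>d n\<bar> \<le> 3" for n
    by (simp add: d_def)
  have "digit_val ?w block_digit = x + ?w ^ m * ?t"
    unfolding x_def using assms(2) block_digit_bounds(3) by (intro digit_val_drop[of _ 3]) auto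
  then have x: "x = - \<beta> / (\<beta> + 1) - ?w ^ m * ?t"
    using assms(3) by simp
  have "x < 1 / (\<beta> + 1)"
    unfolding x_def using assms(2) block_digit_bounds by (intro digit_val_less_dom[of _ _ 3]) auto
  then show "x \<in> negbeta_dom \<beta>"
    using x block_tail_nonpos[OF assms(2,4)] by (simp add: negbeta_dom_def)
  have "digit_val ?w (\<lambda>n. d (k + n)) \<in> negbeta_dom \<beta>" if "k \<ge> 1" for k
    using assms(2) d1 that by (intro digit_val_in_dom) auto
  then have "(negbeta_T \<beta> ^^ m) x = digit_val ?w (\<lambda>n. d (m + n))"
    unfolding x_def d_real using assms(2) d3 by (intro negbeta_orbit_digit_val(1)[of _ _ 3]) auto
  then show "(negbeta_T \<beta> ^^ m) x = 0"
    by (simp add: d_def digit_val_def)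
  have "(- \<beta>) ^ m * ?w ^ m = 1"
    using assms(2) by (simp flip: power_mult_distrib)
  then have "(- \<beta>) ^ m * (?w ^ m * ?t) = ?t"
    by (metis mult.assoc mult_1)
  then show "(- \<beta>) ^ m * x = (- \<beta>) ^ m * (- \<beta> / (\<beta> + 1)) - ?t"
    unfolding x by (simp only: right_diff_distrib)
qed

lemma block_tail_drop_zeros:
  assumes "\<beta> > 1" "\<And>i. i < l \<Longrightarrow> block_word !! (m + i) = 0"
  shows "digit_val (- 1 / \<beta>) (\<lambda>n. block_digit (m + n))
    = (- 1 / \<beta>) ^ l * digit_val (- 1 / \<beta>) (\<lambda>n. block_digit (m + l + n))"
proof -
  have "(\<lambda>n. if n < l then block_digit (m + n) else 0) = (\<lambda>n. 0)"
    using assms(2) by auto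
  then show ?thesis
    using digit_val_drop[of "\<lambda>n. block_digit (m + n)" 3 "- 1 / \<beta>" l] assms(1) block_digit_bounds(3)
    by (simp add: digit_val_def add.assoc)
qed

text \<open>The equation for \<beta> makes the starting point the value of the whole sequence, and
  the orbit lemma reads off its digits.\<close>

lemma block_expansion:
  assumes "\<beta> \<ge> 3" "digit_val (- 1 / \<beta>) block_digit = - \<beta> / (\<beta> + 1)"
  shows "negbeta_expansion \<beta> (- \<beta> / (\<beta> + 1)) = block_word"
proof -
  have "\<bar>block_word !! n\<bar> \<le> 3" for n
    using block_digit_bounds(3)[of n] by simp
  then show ?thesis
    using negbeta_orbit_digit_val[of \<beta> "\<lambda>n. block_word !! n" 3] block_tail_in_dom assms
    by (auto simp: negbeta_expansion_def smap_alt)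
qed

lemma block_integers_close:
  assumes "3 \<le> \<beta>" "\<beta> \<le> 4" "digit_val (- 1 / \<beta>) block_digit = - \<beta> / (\<beta> + 1)"
  obtains x y where "x \<in> negbeta_integers \<beta>" "y \<in> negbeta_integers \<beta>" "x \<noteq> y"
    "dist x y \<le> 5 * (1 / 3) ^ k"
proof -
  let ?w = "- 1 / \<beta>"
  let ?t = "\<lambda>m. digit_val ?w (\<lambda>n. block_digit (m + n))"
  let ?p = "\<lambda>m. digit_val ?w (\<lambda>n. if n < m then block_digit n else 0)"
  obtain m where m: "m \<ge> 1" "\<And>i. i \<le> 2 * k \<Longrightarrow> block_word !! (m + i) = 0"
    "block_word !! (m + (2 * k + 1)) = 1"
    using block_word_zero_run[of k] by blast
  have t: "?t m = ?w ^ l * ?t (m + l)" if "l \<le> 2 * k + 1" for l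
    using block_tail_drop_zeros[of \<beta> l m] m(2) that assms(1) by auto
  have bnd: "\<bar>?t n\<bar> \<le> 1 / 2" if "n \<ge> 1" for n
    using that assms(1) block_digit_bounds(1) by (intro abs_digit_val_le) (auto simp: field_simps)
  \<comment> \<open>The run ends in a 1, and the tail after it has modulus at most 1/2 and cannot
    cancel it; so \<open>?t m\<close> is small but not 0.\<close>
  have "?t (m + (2 * k + 1)) = ?w * (1 + ?t (Suc (m + (2 * k + 1))))"
    using digit_val_Suc[of "\<lambda>n. block_digit (m + (2 * k + 1) + n)" 3 ?w] assms(1)
      block_digit_bounds(3) m(3) by simp
  moreover have "1 + ?t (Suc (m + (2 * k + 1))) \<noteq> 0"
    using bnd[of "Suc (m + (2 * k + 1))"] by auto
  ultimately have nz: "?t m \<noteq> 0"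
    using t[of "2 * k + 1"] assms(1) by auto
  have small: "\<bar>?t m\<bar> \<le> (1 / 3) ^ k"
  proof -
    have "\<bar>?w\<bar> ^ k * \<bar>?t (m + k)\<bar> \<le> (1 / 3) ^ k * 1"
      using assms(1) bnd[of "m + k"] m(1) by (intro mult_mono power_mono) (auto simp: field_simps)
    then show ?thesis
      using t[of k] by (simp add: abs_mult power_abs)
  qed
  have next_t: "?t (Suc m) = - \<beta> * ?t m"
    using t[of 1] assms(1) by (simp add: field_simps)
  \<comment> \<open>\<open>x\<close> is represented by the digit 1 followed by the first
    \<open>m + 1\<close> digits, \<open>y\<close> by the first \<open>m\<close> digits.\<close>
  define x where "x = (- \<beta>) ^ Suc m * (1 + ?p (Suc m))"
  define y where "y = (- \<beta>) ^ m * ?p m"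
  \<comment> \<open>Adding 1 to the left endpoint gives the right one, which
    \<open>- \<beta>\<close> maps back to the left one. The large terms of \<open>x\<close> and
    \<open>y\<close> therefore cancel, leaving \<open>?t m - ?t (Suc m)\<close>.\<close>
  have "(- \<beta>) ^ Suc m * (1 + (- \<beta> / (\<beta> + 1))) = (- \<beta>) ^ m * (- \<beta> / (\<beta> + 1))"
    using assms(1) by (simp add: field_simps)
  then have diff: "x - y = (1 + \<beta>) * ?t m"
    using block_prefix(3)[OF assms(1,3), of "Suc m"] block_prefix(3)[OF assms(1,3), of m] m(1) next_t
    unfolding x_def y_def by (simp only: ring_distribs)
  show thesis
  proof
    show "x \<in> negbeta_integers \<beta>"
      unfolding x_def using block_prefix(1,2)[OF assms(1,3), of "Suc m"] assms(1)
      by (intro negbeta_integers_one_plus) auto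
    show "y \<in> negbeta_integers \<beta>"
      unfolding y_def using block_prefix(1,2)[OF assms(1,3) m(1)]
      by (rule negbeta_integersI)
    show "x \<noteq> y"
      using diff nz assms(1) by auto
    \<comment> \<open>The 5 bounds \<open>1 + \<beta>\<close>, as \<beta> \<le> 4.\<close>
    have "(1 + \<beta>) * \<bar>?t m\<bar> \<le> 5 * (1 / 3) ^ k"
      using small assms(1,2) by (intro mult_mono) auto
    then show "dist x y \<le> 5 * (1 / 3) ^ k"
      using assms(1) by (simp add: dist_real_def diff abs_mult)
  qed
qed

theorem proposition3:
  shows "\<exists>\<beta>::real. \<beta> > 1 \<and>
    negbeta_expansion \<beta> (- \<beta> / (\<beta> + 1)) = block_word \<and>
    \<not> uniform_discrete (negbeta_integers \<beta>)"
proof -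
  obtain \<beta> where \<beta>: "3 \<le> \<beta>" "\<beta> \<le> 4" "digit_val (- 1 / \<beta>) block_digit = - \<beta> / (\<beta> + 1)"
    using block_base_exists .
  have "\<not> uniform_discrete (negbeta_integers \<beta>)"
  proof
    assume "uniform_discrete (negbeta_integers \<beta>)"
    then obtain e where "e > 0"
      and e: "\<And>x y. x \<in> negbeta_integers \<beta> \<Longrightarrow> y \<in> negbeta_integers \<beta> \<Longrightarrow> dist x y < e \<Longrightarrow> x = y"
      unfolding uniform_discrete_def by blast
    from \<open>e > 0\<close> obtain k where "(1 / 3 :: real) ^ k < e / 5"
      using real_arch_pow_inv[of "e / 5" "1 / 3"] by auto
    moreover obtain x y where "x \<in> negbeta_integers \<beta>" "y \<in> negbeta_integers \<beta>" "x \<noteq> y"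
      "dist x y \<le> 5 * (1 / 3) ^ k"
      using block_integers_close[OF \<beta>] .
    ultimately show False
      using e[of x y] by auto
  qed
  then show ?thesis
    using \<beta> block_expansion[OF \<beta>(1,3)] by (intro exI[of _ \<beta>]) auto
qed

end
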